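(* Let $n\ge1$. Every continuous, epi-translation invariant valuation $Z\colon\mathrm{Conv}_{\rm coe}(\mathbb{R}^n)\to\mathbb{R}$ is constant.
   Context: $\mathrm{Conv}(\mathbb{R}^n)$ is the set of convex, lower semicontinuous functions $u\colon\mathbb{R}^n\to\mathbb{R}\cup\{+\infty\}$ with $u\not\equiv+\infty$. $\mathrm{Conv}_{\rm coe}(\mathbb{R}^n)$ is the subset of coercive functions, i.e. those $u\in\mathrm{Conv}(\mathbb{R}^n)$ with $\lim_{|x|\to+\infty}u(x)=+\infty$. Topology: continuity is with respect to epi-convergence. A sequence $u_k$ epi-converges to $u$ if for every $x\in\mathbb{R}^n$: (i) $u(x)\le\liminf_{k\to\infty}u_k(x_k)$ for every sequence $x_k\to x$, and (ii) there is a sequence $x_k\to x$ with $u(x)=\lim_{k\to\infty}u_k(x_k)$. A functional $Z\colon X\to\mathbb{R}$ on a set $X$ of functions is a valuation if $Z(u\vee v)+Z(u\wedge v)=Z(u)+Z(v)$ for all $u,v\in X$ with $u\vee v\in X$ and $u\wedge v\in X$, where $\vee$ and $\wedge$ denote pointwise maximum and minimum. $Z$ is epi-translation invariant if $Z(u\circ\tau^{-1})=Z(u)$ for all $u$ and all translations $\tau$ of $\mathbb{R}^n$, and $Z(u+\alpha)=Z(u)$ for all $u$ and all constants $\alpha\in\mathbb{R}$. *)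

theory Defs
  imports "HOL-Analysis.Analysis"
begin

definition ereal_convex :: "('a::real_vector \<Rightarrow> ereal) \<Rightarrow> bool" where
  "ereal_convex u \<longleftrightarrow>
     (\<forall>x y. \<forall>s\<ge>0. \<forall>t\<ge>0. s + t = 1 \<longrightarrow>
        u (s *\<^sub>R x + t *\<^sub>R y) \<le> ereal s * u x + ereal t * u y)"

definition lower_semicontinuous :: "('a::topological_space \<Rightarrow> ereal) \<Rightarrow> bool" where
  "lower_semicontinuous u \<longleftrightarrow> (\<forall>x. u x \<le> Liminf (at x) u)"

text \<open>The type \<^typ>\<open>ereal\<close> contains \<open>-\<infinity>\<close>, which is excluded explicitly. This also keeps
  \<open>\<infinity> - \<infinity>\<close> out of the convexity inequality; there \<open>0 * \<infinity> = 0\<close> makes the cases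
  \<open>s = 0\<close> and \<open>t = 0\<close> trivial.\<close>

definition Conv :: "('a::euclidean_space \<Rightarrow> ereal) set" where
  "Conv = {u. (\<forall>x. u x \<noteq> -\<infinity>) \<and> (\<exists>x. u x \<noteq> \<infinity>) \<and> ereal_convex u \<and> lower_semicontinuous u}"

definition Conv_coe :: "('a::euclidean_space \<Rightarrow> ereal) set" where
  "Conv_coe = {u \<in> Conv. (u \<longlongrightarrow> \<infinity>) at_infinity}"

definition epi_converges ::
  "(nat \<Rightarrow> 'a::topological_space \<Rightarrow> ereal) \<Rightarrow> ('a \<Rightarrow> ereal) \<Rightarrow> bool" where
  "epi_converges U u \<longleftrightarrow>
     (\<forall>x. (\<forall>X. X \<longlonglongrightarrow> x \<longrightarrow> u x \<le> liminf (\<lambda>k. U k (X k))) \<and>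
          (\<exists>X. X \<longlonglongrightarrow> x \<and> (\<lambda>k. U k (X k)) \<longlonglongrightarrow> u x))"

definition epi_continuous_on ::
  "('a::topological_space \<Rightarrow> ereal) set \<Rightarrow> (('a \<Rightarrow> ereal) \<Rightarrow> real) \<Rightarrow> bool" where
  "epi_continuous_on S Z \<longleftrightarrow>
     (\<forall>U u. (\<forall>k. U k \<in> S) \<longrightarrow> u \<in> S \<longrightarrow> epi_converges U u \<longrightarrow> (\<lambda>k. Z (U k)) \<longlonglongrightarrow> Z u)"

definition valuation_on ::
  "('a \<Rightarrow> ereal) set \<Rightarrow> (('a \<Rightarrow> ereal) \<Rightarrow> real) \<Rightarrow> bool" where
  "valuation_on S Z \<longleftrightarrow>
     (\<forall>u\<in>S. \<forall>v\<in>S. (\<lambda>x. max (u x) (v x)) \<in> S \<longrightarrow> (\<lambda>x. min (u x) (v x)) \<in> S \<longrightarrow>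
        Z (\<lambda>x. max (u x) (v x)) + Z (\<lambda>x. min (u x) (v x)) = Z u + Z v)"

text \<open>The functions \<open>\<lambda>x. x - a\<close> are the inverses of the translations \<open>\<lambda>x. x + a\<close>.\<close>

definition epi_translation_invariant_on ::
  "('a::real_vector \<Rightarrow> ereal) set \<Rightarrow> (('a \<Rightarrow> ereal) \<Rightarrow> real) \<Rightarrow> bool" where
  "epi_translation_invariant_on S Z \<longleftrightarrow>
     (\<forall>u\<in>S. \<forall>a. Z (u \<circ> (\<lambda>x. x - a)) = Z u) \<and>
     (\<forall>u\<in>S. \<forall>\<alpha>::real. Z (\<lambda>x. u x + ereal \<alpha>) = Z u)"

end

theory Submission
  imports Defs
begin

text \<open>
  The key point is that a coercive function may be modified arbitrarily far out without leaving a
  small epi-neighbourhood. Suppose the domain of \<open>v\<close> lies on one side of a hyperplane \<open>H\<close>, and \<open>P\<close>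
  is a projection onto \<open>H\<close> mapping this domain into itself with \<open>v \<ge> v \<circ> P\<close>. A translate of \<open>v\<close> can
  then be glued to the coercive cylinder \<open>g = v \<circ> P + s dist\<close> at distance \<open>k\<close> from \<open>H\<close>. Both the
  glued function and the truncated \<open>g\<close> epi-converge to \<open>g\<close> as \<open>k\<close> grows, so the valuation property
  yields \<open>Z v = Z (v restricted to H)\<close>.

  An affine function on a polytope can be cut by hyperplanes into pieces of this kind: choose a
  direction \<open>d\<close> along which it does not decrease, and cut so that on each piece the lines in
  direction \<open>d\<close> all enter through the same facet. By induction on the dimension, \<open>Z\<close> takes the same
  value as on a point. Further cuts extend this to maxima of affine functions on polytopes, and
  these are epi-dense.
\<close>

section \<open>Restricted functions, membership in \<open>Conv_coe\<close>, and
  epi-convergence\<close>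

text \<open>This is \<open>f\<close> plus the convex indicator function of \<open>S\<close>. For two
  restrictions of one \<open>f\<close>, minimum and maximum correspond to union and intersection of
  the sets.\<close>

definition restr :: "('a \<Rightarrow> real) \<Rightarrow> 'a set \<Rightarrow> 'a \<Rightarrow> ereal" where
  "restr f S = (\<lambda>x. if x \<in> S then ereal (f x) else \<infinity>)"

text \<open>A constant sequence serves as recovery sequence: \<open>lower\<close> and
  \<open>upper\<close> together force convergence along it.\<close>

lemma epi_convergesI:
  fixes u :: "'a::topological_space \<Rightarrow> ereal"
  assumes lower: "\<And>x X y. X \<longlonglongrightarrow> x \<Longrightarrow> y < u x \<Longrightarrow> eventually (\<lambda>k. y < U k (X k)) sequentially"
    and upper: "\<And>x y. u x < y \<Longrightarrow> eventually (\<lambda>k. U k x < y) sequentially"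
  shows "epi_converges U u"
  unfolding epi_converges_def
proof (intro allI conjI impI)
  show "u x \<le> liminf (\<lambda>k. U k (X k))" if "X \<longlonglongrightarrow> x" for x X
    using lower[OF that] by (simp add: le_Liminf_iff)
  show "\<exists>X. X \<longlonglongrightarrow> x \<and> (\<lambda>k. U k (X k)) \<longlonglongrightarrow> u x" for x
    by (rule exI[of _ "\<lambda>_. x"]) (auto intro!: order_tendstoI lower upper)
qed

lemma lower_semicontinuous_iff:
  "lower_semicontinuous u \<longleftrightarrow> (\<forall>x y. y < u x \<longrightarrow> eventually (\<lambda>z. y < u z) (at x))"
  by (simp add: lower_semicontinuous_def le_Liminf_iff)

lemma lower_semicontinuous_nhds:
  assumes "lower_semicontinuous u" "y < u x"
  shows "eventually (\<lambda>z. y < u z) (nhds x)"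
proof -
  have "eventually (\<lambda>z. z \<noteq> x \<longrightarrow> y < u z) (nhds x)"
    using assms by (simp add: lower_semicontinuous_iff eventually_at_filter)
  then show ?thesis by (rule eventually_mono) (use assms(2) in blast)
qed

lemma eventually_lower_semicontinuous_seq:
  assumes "lower_semicontinuous u" "y < u x" "X \<longlonglongrightarrow> x"
  shows "eventually (\<lambda>k. y < u (X k)) sequentially"
  using lower_semicontinuous_nhds[OF assms(1,2)] assms(3)[unfolded filterlim_iff] by blast

lemma lower_semicontinuous_restr:
  fixes f :: "'a::topological_space \<Rightarrow> real"
  assumes "closed S" "continuous_on S f"
  shows "lower_semicontinuous (restr f S)"
  unfolding lower_semicontinuous_iff
proof (intro allI impI)
  fix x y assume y: "y < restr f S x"
  show "eventually (\<lambda>z. y < restr f S z) (at x)"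
  proof (cases "x \<in> S")
    case True
    then have "((\<lambda>z. ereal (f z)) \<longlongrightarrow> ereal (f x)) (at x within S)"
      using assms(2) by (auto simp: continuous_on_def)
    then have "eventually (\<lambda>z. y < ereal (f z)) (at x within S)"
      by (rule order_tendstoD) (use y True in \<open>simp add: restr_def\<close>)
    moreover have "y < \<infinity>" using y by (metis less_le_trans ereal_less_eq(1))
    ultimately show ?thesis
      by (auto simp: eventually_at_filter restr_def elim: eventually_mono)
  next
    case False
    then have "eventually (\<lambda>z. z \<in> - S) (at x)"
      using assms(1) by (intro eventually_at_in_open') auto
    then show ?thesis
      using y False by (auto simp: restr_def elim: eventually_mono)
  qed
qed

lemma ereal_convex_restr:
  assumes "convex_on S f"
  shows "ereal_convex (restr f S)"
  unfolding ereal_convex_def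
proof (intro allI impI)
  fix x y and s t :: real assume st: "0 \<le> s" "0 \<le> t" "s + t = 1"
  show "restr f S (s *\<^sub>R x + t *\<^sub>R y) \<le> ereal s * restr f S x + ereal t * restr f S y"
  proof (cases "s = 0 \<or> t = 0")
    case True
    then show ?thesis using st by (auto simp flip: zero_ereal_def one_ereal_def)
  next
    case False
    then have pos: "s > 0" "t > 0" using st by auto
    show ?thesis
    proof (cases "x \<in> S \<and> y \<in> S")
      case True
      have "s *\<^sub>R x + t *\<^sub>R y \<in> S"
        using True assms st by (auto simp: convex_on_def convex_def)
      moreover have "f (s *\<^sub>R x + t *\<^sub>R y) \<le> s * f x + t * f y"
        using True assms st by (auto simp: convex_on_def)
      ultimately show ?thesis using True by (simp add: restr_def)
    next
      case False
      \<comment> \<open>Both weights are positive, so a single value \<infinity> makes the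
        right-hand side \<infinity>.\<close>
      then show ?thesis using pos by (auto simp: restr_def)
    qed
  qed
qed

lemma coercive_iff:
  fixes u :: "'a::real_normed_vector \<Rightarrow> ereal"
  shows "(u \<longlongrightarrow> \<infinity>) at_infinity \<longleftrightarrow> (\<forall>r. \<exists>b. \<forall>x. b \<le> norm x \<longrightarrow> ereal r < u x)"
  by (simp add: tendsto_PInfty eventually_at_infinity)

lemma restr_in_Conv_coe:
  fixes f :: "'a::euclidean_space \<Rightarrow> real"
  assumes "convex_on S f" "continuous_on S f" "closed S" "S \<noteq> {}"
    and coe: "\<And>r. \<exists>b. \<forall>x\<in>S. b \<le> norm x \<longrightarrow> r < f x"
  shows "restr f S \<in> Conv_coe"
proof -
  have "\<exists>b. \<forall>x. b \<le> norm x \<longrightarrow> ereal r < restr f S x" for r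
    using coe[of r] by (auto simp: restr_def)
  moreover have "restr f S x \<noteq> -\<infinity>" for x by (simp add: restr_def)
  moreover have "\<exists>x. restr f S x \<noteq> \<infinity>" using assms(4) by (auto simp: restr_def)
  ultimately show ?thesis
    using ereal_convex_restr[OF assms(1)] lower_semicontinuous_restr[OF assms(3,2)]
    by (simp add: Conv_coe_def Conv_def coercive_iff)
qed

lemma restr_compact_in_Conv_coe:
  fixes f :: "'a::euclidean_space \<Rightarrow> real"
  assumes "convex_on UNIV f" "compact K" "convex K" "K \<noteq> {}"
  shows "restr f K \<in> Conv_coe"
proof (rule restr_in_Conv_coe)
  show "convex_on K f" using assms convex_on_subset by blast
  show "continuous_on K f"
    using assms(1) convex_on_continuous continuous_on_subset by blast
  show "closed K" using assms by (simp add: compact_imp_closed)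
  show "\<exists>b. \<forall>x\<in>K. b \<le> norm x \<longrightarrow> r < f x" for r
  proof -
    obtain b where "\<forall>x\<in>K. norm x \<le> b" using assms compact_imp_bounded bounded_iff by blast
    \<comment> \<open>Coercivity is vacuous: no point of \<open>K\<close> has norm
      \<open>b + 1\<close> or more.\<close>
    then show ?thesis by (intro exI[of _ "b + 1"]) force
  qed
qed fact

text \<open>Lower semicontinuity, properness and coercivity pass to minima; only convexity can get
  lost and has to be supplied.\<close>

lemma min_in_Conv_coe:
  fixes u v :: "'a::euclidean_space \<Rightarrow> ereal"
  assumes "u \<in> Conv_coe" "v \<in> Conv_coe" "ereal_convex (\<lambda>x. min (u x) (v x))"
  shows "(\<lambda>x. min (u x) (v x)) \<in> Conv_coe"
proof -
  have "lower_semicontinuous (\<lambda>x. min (u x) (v x))"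
    using assms(1,2)
    by (auto simp: Conv_coe_def Conv_def lower_semicontinuous_iff intro: eventually_conj)
  moreover have "((\<lambda>x. min (u x) (v x)) \<longlongrightarrow> \<infinity>) at_infinity"
    using assms(1,2) tendsto_min[of u \<infinity> at_infinity v \<infinity>] by (simp add: Conv_coe_def)
  ultimately show ?thesis
    using assms by (auto simp: Conv_coe_def Conv_def min_def)
qed

text \<open>On \<open>S\<close> the continuous convergence of \<open>F k\<close> to \<open>f\<close>
  gives both conditions, and where a sequence leaves \<open>S\<close> the value \<infinity> only
  helps the lower bound. A point outside the closed set \<open>S\<close> has a neighbourhood missing
  it.\<close>

lemma epi_converges_restr:
  fixes f :: "'a::t1_space \<Rightarrow> real"
  assumes "closed S"
    and conv: "\<And>x X. X \<longlonglongrightarrow> x \<Longrightarrow> (\<lambda>k. F k (X k)) \<longlonglongrightarrow> f x"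
  shows "epi_converges (\<lambda>k. restr (F k) S) (restr f S)"
proof (rule epi_convergesI)
  fix x X y assume X: "X \<longlonglongrightarrow> x" and y: "y < restr f S x"
  show "\<forall>\<^sub>F k in sequentially. y < restr (F k) S (X k)"
  proof (cases "x \<in> S")
    case True
    have "(\<lambda>k. ereal (F k (X k))) \<longlonglongrightarrow> ereal (f x)" using conv[OF X] by simp
    then have "\<forall>\<^sub>F k in sequentially. y < ereal (F k (X k))"
      by (rule order_tendstoD) (use y True in \<open>simp add: restr_def\<close>)
    moreover have "y < \<infinity>" using y by (metis less_le_trans ereal_less_eq(1))
    ultimately show ?thesis by (auto simp: restr_def elim: eventually_mono)
  next
    case False
    then have "\<forall>\<^sub>F k in sequentially. X k \<in> - S"
      using assms(1) X by (intro topological_tendstoD) auto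
    then show ?thesis using y False by (auto simp: restr_def elim: eventually_mono)
  qed
next
  fix x y assume y: "restr f S x < y"
  have "(\<lambda>k. ereal (F k x)) \<longlonglongrightarrow> ereal (f x)" using conv[of "\<lambda>_. x" x] by simp
  then show "\<forall>\<^sub>F k in sequentially. restr (F k) S x < y"
    using y order_tendstoD(2)[of _ "ereal (f x)" sequentially y] by (cases "x \<in> S") (auto simp: restr_def)
qed

text \<open>Meant for functions altered only beyond a hyperplane that escapes to infinity: along any
  convergent sequence the alteration eventually disappears.\<close>

lemma epi_converges_eventually_eq:
  fixes u :: "'a::topological_space \<Rightarrow> ereal"
  assumes "lower_semicontinuous u"
    and eq: "\<And>x X. X \<longlonglongrightarrow> x \<Longrightarrow> \<forall>\<^sub>F k in sequentially. U k (X k) = u (X k)"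
  shows "epi_converges U u"
proof (rule epi_convergesI)
  fix x X y assume "X \<longlonglongrightarrow> x" "y < u x"
  from eventually_lower_semicontinuous_seq[OF assms(1) this(2,1)] eq[OF this(1)]
  show "\<forall>\<^sub>F k in sequentially. y < U k (X k)" by eventually_elim simp
next
  fix x y assume "u x < y"
  with eq[of "\<lambda>_. x" x] show "\<forall>\<^sub>F k in sequentially. U k x < y"
    by (auto elim: eventually_mono)
qed

section \<open>Gluing two convex functions along a hyperplane\<close>

text \<open>Since \<open>g \<le> v\<close> on \<open>B\<close>, a convex combination on the
  \<open>g\<close> side is controlled by \<open>g\<close> alone. The critical case is a combination
  on the \<open>v\<close> side with one endpoint strictly below the hyperplane. The segment crosses
  the hyperplane at a point \<open>z\<close> where both functions agree: convexity of
  \<open>g\<close> bounds the value at \<open>z\<close>, and convexity of \<open>v\<close> handles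
  the part beyond \<open>z\<close>.\<close>

lemma convex_on_glue:
  fixes a :: "'a::real_inner"
  assumes g: "convex_on C g" and v: "convex_on B v" and BC: "B \<subseteq> C"
    and Bk: "\<And>x. x \<in> B \<Longrightarrow> k \<le> a \<bullet> x" and gv: "\<And>x. x \<in> B \<Longrightarrow> g x \<le> v x"
    and eq: "\<And>x. x \<in> C \<Longrightarrow> a \<bullet> x = k \<Longrightarrow> x \<in> B \<and> v x = g x"
  shows "convex_on (C \<inter> {x. a \<bullet> x \<le> k} \<union> B) (\<lambda>x. if a \<bullet> x \<le> k then g x else v x)"
proof -
  let ?S = "C \<inter> {x. a \<bullet> x \<le> k} \<union> B" and ?G = "\<lambda>x. if a \<bullet> x \<le> k then g x else v x"
  have SC: "x \<in> C" if "x \<in> ?S" for x using that BC by blast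
  have gG: "g x \<le> ?G x" if "x \<in> ?S" for x using that gv by auto
  have G_B: "?G x = v x" if "x \<in> B" for x
    using that eq[of x] Bk[of x] BC by (auto intro: antisym)
  have in_B: "x \<in> B" if "x \<in> ?S" "k \<le> a \<bullet> x" for x
    using that eq[of x] by (auto intro: antisym)
  have v_ineq: "r *\<^sub>R x + t *\<^sub>R y \<in> B \<and> v (r *\<^sub>R x + t *\<^sub>R y) \<le> r * v x + t * v y"
    if "x \<in> B" "y \<in> B" "0 \<le> r" "0 \<le> t" "r + t = 1" for x y r t
    using that v unfolding convex_on_def convex_def by blast
  have g_ineq: "r *\<^sub>R x + t *\<^sub>R y \<in> C \<and> g (r *\<^sub>R x + t *\<^sub>R y) \<le> r * g x + t * g y"
    if "x \<in> C" "y \<in> C" "0 \<le> r" "0 \<le> t" "r + t = 1" for x y r t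
    using that g unfolding convex_on_def convex_def by blast
  have mixed: "r *\<^sub>R x + t *\<^sub>R y \<in> ?S \<and> ?G (r *\<^sub>R x + t *\<^sub>R y) \<le> r * ?G x + t * ?G y"
    if xy: "x \<in> ?S" "y \<in> ?S" and rt: "0 \<le> r" "0 \<le> t" "r + t = 1"
      and x: "a \<bullet> x < k" and m: "k < a \<bullet> (r *\<^sub>R x + t *\<^sub>R y)" for x y r t
  proof -
    have m': "k < r * (a \<bullet> x) + t * (a \<bullet> y)" using m by (simp add: inner_simps)
    have y: "k < a \<bullet> y"
    proof (rule ccontr)
      assume "\<not> k < a \<bullet> y"
      then have "r * (a \<bullet> x) + t * (a \<bullet> y) \<le> r * k + t * k"
        using x rt by (intro add_mono mult_left_mono) auto
      also have "\<dots> = k" using rt by (metis distrib_right mult_1)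
      finally show False using m' by simp
    qed
    \<comment> \<open>\<open>\<alpha>\<close> and \<open>\<beta>\<close> are the barycentric
      coordinates of the point \<open>z\<close> where the segment from \<open>x\<close> to
      \<open>y\<close> meets the hyperplane.\<close>
    define D where "D = a \<bullet> y - a \<bullet> x"
    define \<alpha> where "\<alpha> = (a \<bullet> y - k) / D"
    define \<beta> where "\<beta> = (k - a \<bullet> x) / D"
    have D: "D > 0" using x y by (simp add: D_def)
    have \<alpha>: "\<alpha> > 0" and \<beta>: "\<beta> > 0" using x y D by (auto simp: \<alpha>_def \<beta>_def)
    have ab: "\<alpha> + \<beta> = 1"
      using D by (simp add: \<alpha>_def \<beta>_def D_def flip: add_divide_distrib)
    define z where "z = \<alpha> *\<^sub>R x + \<beta> *\<^sub>R y"
    have "a \<bullet> z = (a \<bullet> y - k) / D * (a \<bullet> x) + (k - a \<bullet> x) / D * (a \<bullet> y)"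
      by (simp add: z_def \<alpha>_def \<beta>_def inner_simps)
    also have "\<dots> = k * D / D"
      by (simp add: D_def algebra_simps flip: add_divide_distrib diff_divide_distrib)
    finally have hz: "a \<bullet> z = k" using D by simp
    have zC: "z \<in> C" and gz: "g z \<le> \<alpha> * g x + \<beta> * g y"
      using g_ineq[of x y \<alpha> \<beta>] SC xy \<alpha> \<beta> ab by (auto simp: z_def)
    have zB: "z \<in> B" and vz: "v z = g z" using eq[OF zC hz] by auto
    have yB: "y \<in> B" using in_B xy y by simp
    have "t = 1 - r" using rt by simp
    then have "k < r * (a \<bullet> x) + (1 - r) * (a \<bullet> y)" using m' by simp
    then have "r * D < a \<bullet> y - k" by (simp add: D_def algebra_simps)
    then have r\<alpha>: "r \<le> \<alpha>" using D by (simp add: \<alpha>_def field_simps)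
    \<comment> \<open>The combination lies between \<open>z\<close> and \<open>y\<close>, and
      \<open>l\<close> is its weight at \<open>z\<close>; comparing the coefficients of
      \<open>x\<close> forces \<open>l * \<alpha> = r\<close>.\<close>
    define l where "l = r / \<alpha>"
    have l: "0 \<le> l" "l \<le> 1" "l * \<alpha> = r" using r\<alpha> \<alpha> rt by (auto simp: l_def)
    have t: "t = l * \<beta> + (1 - l)"
      using l rt ab by (smt (verit) distrib_left mult_cancel_left2)
    have m_eq: "r *\<^sub>R x + t *\<^sub>R y = l *\<^sub>R z + (1 - l) *\<^sub>R y"
      using l(3) t by (simp add: z_def scaleR_add_right scaleR_add_left)
    have mB: "r *\<^sub>R x + t *\<^sub>R y \<in> B"
      and "v (r *\<^sub>R x + t *\<^sub>R y) \<le> l * v z + (1 - l) * v y"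
      using v_ineq[OF zB yB, of l "1 - l"] l by (auto simp: m_eq)
    note this(2)
    moreover have "l * v z \<le> l * (\<alpha> * g x + \<beta> * g y)"
      using gz vz l by (intro mult_left_mono) auto
    moreover have "l * (\<alpha> * g x + \<beta> * g y) = r * g x + l * \<beta> * g y"
      using l(3) by (simp add: algebra_simps)
    moreover have "l * \<beta> * g y \<le> l * \<beta> * v y"
      using gv[OF yB] l \<beta> by (intro mult_left_mono) auto
    moreover have "r * g x \<le> r * ?G x" using gG[OF xy(1)] rt by (intro mult_left_mono) auto
    moreover have "l * \<beta> * v y + (1 - l) * v y = t * v y"
      by (simp add: t algebra_simps)
    ultimately have "v (r *\<^sub>R x + t *\<^sub>R y) \<le> r * ?G x + t * v y" by linarith
    then show ?thesis using mB G_B[OF mB] G_B[OF yB] by auto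
  qed
  have "r *\<^sub>R x + t *\<^sub>R y \<in> ?S \<and> ?G (r *\<^sub>R x + t *\<^sub>R y) \<le> r * ?G x + t * ?G y"
    if xy: "x \<in> ?S" "y \<in> ?S" and rt: "0 \<le> r" "0 \<le> t" "r + t = 1" for x y r t
  proof (cases "a \<bullet> (r *\<^sub>R x + t *\<^sub>R y) \<le> k")
    case True
    have C: "r *\<^sub>R x + t *\<^sub>R y \<in> C" using g_ineq[of x y r t] SC xy rt by auto
    have "g (r *\<^sub>R x + t *\<^sub>R y) \<le> r * g x + t * g y"
      using g_ineq[of x y r t] SC xy rt by auto
    also have "\<dots> \<le> r * ?G x + t * ?G y"
      using gG xy rt by (intro add_mono mult_left_mono) auto
    finally show ?thesis using True C by auto
  next
    case False
    consider "a \<bullet> x < k" | "a \<bullet> y < k" | "k \<le> a \<bullet> x" "k \<le> a \<bullet> y" by linarith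
    then show ?thesis
    proof cases
      case 1
      then show ?thesis using mixed[of x y r t] xy rt False by simp
    next
      case 2
      then show ?thesis using mixed[of y x t r] xy rt False by (simp add: add.commute)
    next
      case 3
      then have B: "x \<in> B" "y \<in> B" using in_B xy by auto
      then show ?thesis
        using v_ineq[of x y r t] rt G_B[OF B(1)] G_B[OF B(2)] False by auto
    qed
  qed
  then show ?thesis unfolding convex_on_def convex_def by blast
qed

lemma convex_combination_diff:
  fixes x y d :: "'a::real_vector"
  assumes "u + v = 1"
  shows "u *\<^sub>R x + v *\<^sub>R y - d = u *\<^sub>R (x - d) + v *\<^sub>R (y - d)"
proof -
  have "d = u *\<^sub>R d + v *\<^sub>R d" using assms by (simp flip: scaleR_left_distrib)
  then show ?thesis by (metis add_diff_add scaleR_diff_right)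
qed

section \<open>Translations, hyperplane cuts and projection onto a face\<close>

locale epi_invariant_valuation =
  fixes Z :: "('a::euclidean_space \<Rightarrow> ereal) \<Rightarrow> real"
  assumes continuous: "epi_continuous_on Conv_coe Z"
    and invariant: "epi_translation_invariant_on Conv_coe Z"
    and valuation: "valuation_on Conv_coe Z"
begin

lemma Z_tendsto:
  assumes "\<And>k. U k \<in> Conv_coe" "u \<in> Conv_coe" "epi_converges U u"
  shows "(\<lambda>k. Z (U k)) \<longlonglongrightarrow> Z u"
  using continuous assms by (auto simp: epi_continuous_on_def)

lemma Z_valuation:
  assumes "u \<in> Conv_coe" "v \<in> Conv_coe"
    and "(\<lambda>x. max (u x) (v x)) \<in> Conv_coe" "(\<lambda>x. min (u x) (v x)) \<in> Conv_coe"
  shows "Z (\<lambda>x. max (u x) (v x)) + Z (\<lambda>x. min (u x) (v x)) = Z u + Z v"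
  using valuation assms by (simp add: valuation_on_def)

text \<open>Both invariances at once: the epigraph of \<open>restr f K\<close> is moved by the
  vector \<open>(d, s)\<close>.\<close>

lemma Z_translate:
  assumes f: "convex_on UNIV f" and K: "compact K" "convex K" "K \<noteq> {}"
  shows "restr (\<lambda>x. f (x - d) + s) {x. x - d \<in> K} \<in> Conv_coe" (is "?in")
    and "Z (restr (\<lambda>x. f (x - d) + s) {x. x - d \<in> K}) = Z (restr f K)" (is "?eq")
proof -
  have "x \<in> (+) d ` K" if "x - d \<in> K" for x
    using imageI[OF that, of "(+) d"] by simp
  then have S: "{x. x - d \<in> K} = (+) d ` K" by auto
  have translate: "convex_on UNIV (\<lambda>x. f (x - d))"
  proof -
    have "f (u *\<^sub>R x + v *\<^sub>R y - d) \<le> u * f (x - d) + v * f (y - d)"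
      if "0 \<le> u" "0 \<le> v" "u + v = 1" for u v x y
      using f that by (simp add: convex_combination_diff convex_on_def)
    then show ?thesis by (simp add: convex_on_def)
  qed
  have in0: "restr (\<lambda>x. f (x - d)) {x. x - d \<in> K} \<in> Conv_coe"
    unfolding S using translate K
    by (intro restr_compact_in_Conv_coe compact_translation convex_translation) auto
  show ?in
    unfolding S using translate K
    by (intro restr_compact_in_Conv_coe compact_translation convex_translation
        convex_on_add convex_on_const[THEN iffD2]) auto
  have "Z (restr (\<lambda>x. f (x - d) + s) {x. x - d \<in> K})
      = Z (\<lambda>x. restr (\<lambda>x. f (x - d)) {x. x - d \<in> K} x + ereal s)"
    by (rule arg_cong[where f = Z]) (auto simp: restr_def)
  also have "\<dots> = Z (restr (\<lambda>x. f (x - d)) {x. x - d \<in> K})"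
    using invariant in0 by (auto simp: epi_translation_invariant_on_def)
  also have "\<dots> = Z (restr f K \<circ> (\<lambda>x. x - d))"
    by (rule arg_cong[where f = Z]) (auto simp: restr_def)
  also have "\<dots> = Z (restr f K)"
    using invariant restr_compact_in_Conv_coe[OF f K]
    by (auto simp: epi_translation_invariant_on_def)
  finally show ?eq .
qed

text \<open>The restrictions to the two halves have minimum \<open>restr f K\<close> and, as
  maximum, the restriction to the section. Connectedness of \<open>K\<close> makes the section
  nonempty, so that this maximum is proper.\<close>

lemma Z_hyperplane_cut:
  assumes f: "convex_on UNIV f" and K: "compact K" "convex K"
    and le: "K \<inter> {x. a \<bullet> x \<le> b} \<noteq> {}" and ge: "K \<inter> {x. a \<bullet> x \<ge> b} \<noteq> {}"
  shows "Z (restr f K) + Z (restr f (K \<inter> {x. a \<bullet> x = b}))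
    = Z (restr f (K \<inter> {x. a \<bullet> x \<le> b})) + Z (restr f (K \<inter> {x. a \<bullet> x \<ge> b}))"
proof -
  let ?u = "restr f (K \<inter> {x. a \<bullet> x \<le> b})" and ?v = "restr f (K \<inter> {x. a \<bullet> x \<ge> b})"
  obtain x y where "x \<in> K" "y \<in> K" "a \<bullet> x \<le> b" "b \<le> a \<bullet> y" using le ge by auto
  then have eq: "K \<inter> {x. a \<bullet> x = b} \<noteq> {}"
    using connected_ivt_hyperplane[OF convex_connected[OF K(2)]] by blast
  have "?u \<in> Conv_coe" "?v \<in> Conv_coe" "restr f (K \<inter> {x. a \<bullet> x = b}) \<in> Conv_coe"
    using le ge eq K
    by (auto intro!: restr_compact_in_Conv_coe[OF f] compact_Int_closed convex_Int
        closed_halfspace_le closed_halfspace_ge closed_hyperplane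
        convex_halfspace_le convex_halfspace_ge convex_hyperplane)
  moreover have "restr f K \<in> Conv_coe"
    using le K by (intro restr_compact_in_Conv_coe[OF f]) auto
  moreover have "(\<lambda>x. min (?u x) (?v x)) = restr f K"
    by (auto simp: restr_def fun_eq_iff)
  moreover have "(\<lambda>x. max (?u x) (?v x)) = restr f (K \<inter> {x. a \<bullet> x = b})"
    by (auto simp: restr_def fun_eq_iff)
  ultimately show ?thesis using Z_valuation[of ?u ?v] by simp
qed

text \<open>The cylinder \<open>g\<close> is considered on \<open>C\<close>, the union of the lines
  in direction \<open>d\<close> through the face \<open>F\<close>. For \<open>k \<ge> 0\<close>,
  \<open>?p k\<close> is \<open>g\<close> cut off at \<open>a \<bullet> x = b + k\<close>, and
  \<open>?q k\<close> is \<open>restr f K\<close> moved by \<open>k\<close> times \<open>d\<close>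
  and raised by \<open>s * k\<close>. Their maximum is a translate of \<open>restr f F\<close>, so
  \<open>Z (restr f F) + Z (?m k) = Z (?p k) + Z (restr f K)\<close>. As \<open>?p k\<close> and
  \<open>?m k\<close> both epi-converge to \<open>restr g C\<close>, their contributions cancel in
  the limit.\<close>

lemma Z_project_to_face_strict:
  fixes d :: 'a
  assumes f: "convex_on UNIV f" and K: "compact K" "convex K" "K \<noteq> {}"
    and ad: "a \<bullet> d = 1" and s: "s > 0"
    and nonneg: "\<And>x. x \<in> K \<Longrightarrow> b \<le> a \<bullet> x"
    and proj: "\<And>x. x \<in> K \<Longrightarrow> x - (a \<bullet> x - b) *\<^sub>R d \<in> K"
    and slope: "\<And>x. x \<in> K \<Longrightarrow> f (x - (a \<bullet> x - b) *\<^sub>R d) + s * (a \<bullet> x - b) \<le> f x"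
  shows "Z (restr f K) = Z (restr f (K \<inter> {x. a \<bullet> x = b}))"
proof -
  define P where "P x = x - (a \<bullet> x - b) *\<^sub>R d" for x
  \<comment> \<open>The absolute value makes \<open>g\<close> grow towards both ends of each line;
    with \<open>s > 0\<close> this yields coercivity on \<open>C\<close>.\<close>
  define g where "g x = f (P x) + s * \<bar>a \<bullet> x - b\<bar>" for x
  define C where "C = {x. P x \<in> K}"
  define F where "F = K \<inter> {x. a \<bullet> x = b}"
  define B where "B k = {x. x - k *\<^sub>R d \<in> K}" for k :: real
  \<comment> \<open>The lift by \<open>s * k\<close> makes \<open>q k\<close> agree with
    \<open>g\<close> on the hyperplane \<open>a \<bullet> x = b + k\<close>, where
    \<open>x - k *\<^sub>R d = P x\<close>.\<close>
  define q where "q k x = f (x - k *\<^sub>R d) + s * k" for k x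
  have aP: "a \<bullet> P x = b" for x by (simp add: P_def inner_simps ad)
  have P_id: "P x = x" if "a \<bullet> x = b" for x using that by (simp add: P_def)
  have P_shift: "P (x - k *\<^sub>R d) = P x" for x k
    by (simp add: P_def inner_simps ad algebra_simps)
  have ax: "a \<bullet> (x - k *\<^sub>R d) = a \<bullet> x - k" for x k by (simp add: inner_simps ad)
  have P_affine: "P (u *\<^sub>R x + v *\<^sub>R y) = u *\<^sub>R P x + v *\<^sub>R P y" if "u + v = 1" for u v x y
  proof -
    have "b = u * b + v * b" using that by (simp flip: distrib_right)
    then have "a \<bullet> (u *\<^sub>R x + v *\<^sub>R y) - b = u * (a \<bullet> x - b) + v * (a \<bullet> y - b)"
      by (simp add: inner_simps right_diff_distrib)
    then show ?thesis
      by (simp add: P_def scaleR_diff_right scaleR_left_distrib)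
  qed
  have cont_P: "continuous_on UNIV P" unfolding P_def by (intro continuous_intros)
  have cont_f: "continuous_on UNIV f" using f convex_on_continuous by blast
  have cont_g: "continuous_on UNIV g"
    unfolding g_def
    by (intro continuous_intros continuous_on_compose2[OF cont_f cont_P]) auto
  have "f (P (u *\<^sub>R x + v *\<^sub>R y)) \<le> u * f (P x) + v * f (P y)"
    if "0 \<le> u" "0 \<le> v" "u + v = 1" for u v x y
    using that f by (simp add: P_affine convex_on_def)
  then have "convex_on UNIV (\<lambda>x. f (P x))" by (simp add: convex_on_def)
  moreover have "\<bar>a \<bullet> (u *\<^sub>R x + v *\<^sub>R y) - b\<bar> \<le> u * \<bar>a \<bullet> x - b\<bar> + v * \<bar>a \<bullet> y - b\<bar>"
    if "0 \<le> u" "0 \<le> v" "u + v = 1" for u v x y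
  proof -
    have "b = u * b + v * b" using that by (simp flip: distrib_right)
    then have "a \<bullet> (u *\<^sub>R x + v *\<^sub>R y) - b = u * (a \<bullet> x - b) + v * (a \<bullet> y - b)"
      by (simp add: inner_simps right_diff_distrib)
    then show ?thesis
      using that abs_triangle_ineq[of "u * (a \<bullet> x - b)" "v * (a \<bullet> y - b)"]
      by (simp add: abs_mult)
  qed
  then have "convex_on UNIV (\<lambda>x. \<bar>a \<bullet> x - b\<bar>)" by (simp add: convex_on_def)
  ultimately have g: "convex_on UNIV g"
    unfolding g_def using s by (intro convex_on_add convex_on_cmul) auto
  have closed_C: "closed C"
    unfolding C_def using K continuous_closed_vimage[of K P] cont_P
    by (simp add: compact_imp_closed continuous_on_eq_continuous_at vimage_def)
  have convex_C: "convex C"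
    unfolding convex_def C_def using K(2) by (auto simp: P_affine convexD)
  obtain z where z: "z \<in> K" "a \<bullet> z = b"
    using K(3) proj aP unfolding P_def by blast
  have zC: "z \<in> C" using z by (simp add: C_def P_id)
  have F: "compact F" "convex F" "F \<noteq> {}"
    unfolding F_def using K z
    by (auto intro!: compact_Int_closed convex_Int closed_hyperplane convex_hyperplane)
  have coercive: "\<exists>e. \<forall>x\<in>C. e \<le> norm x \<longrightarrow> r < g x" for r
  proof -
    have "compact (f ` K)" using cont_f K(1) compact_continuous_image continuous_on_subset by blast
    then obtain m where m: "\<forall>y\<in>f ` K. norm y \<le> m"
      using compact_imp_bounded bounded_iff by blast
    obtain R where R: "\<forall>y\<in>K. norm y \<le> R"
      using K compact_imp_bounded bounded_iff by blast
    \<comment> \<open>\<open>\<bar>f\<bar>\<close> is at most \<open>m\<close> on \<open>K\<close>,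
      and points of \<open>C\<close> far out satisfy
      \<open>\<bar>a \<bullet> x - b\<bar> > t\<close>; the choice makes \<open>s * t\<close> exceed
      \<open>\<bar>r\<bar> + \<bar>m\<bar>\<close>.\<close>
    define t where "t = (\<bar>r\<bar> + \<bar>m\<bar>) / s + 1"
    have "r < g x" if x: "x \<in> C" "R + t * norm d + 1 \<le> norm x" for x
    proof -
      have "x = P x + (a \<bullet> x - b) *\<^sub>R d" by (simp add: P_def)
      then have "norm x \<le> norm (P x) + \<bar>a \<bullet> x - b\<bar> * norm d"
        by (metis norm_triangle_ineq norm_scaleR)
      moreover have "norm (P x) \<le> R" using x R by (simp add: C_def)
      ultimately have "t * norm d < \<bar>a \<bullet> x - b\<bar> * norm d" using x by linarith
      then have "t < \<bar>a \<bullet> x - b\<bar>" by (simp add: mult_less_cancel_right)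
      then have "s * t < s * \<bar>a \<bullet> x - b\<bar>" using s by simp
      moreover have "s * t = \<bar>r\<bar> + \<bar>m\<bar> + s" using s by (simp add: t_def field_simps)
      moreover have "\<bar>f (P x)\<bar> \<le> m" using m x by (simp add: C_def)
      ultimately show ?thesis using s unfolding g_def by linarith
    qed
    then show ?thesis by blast
  qed
  have g_in: "restr g C \<in> Conv_coe"
    using g cont_g convex_C closed_C zC coercive
    by (intro restr_in_Conv_coe) (auto intro: convex_on_subset continuous_on_subset)
  let ?p = "\<lambda>k. restr g (C \<inter> {x. a \<bullet> x \<le> b + k})"
  let ?q = "\<lambda>k. restr (q k) (B k)"
  let ?m = "\<lambda>k x. min (?p k x) (?q k x)"
  have p_in: "?p k \<in> Conv_coe" if "k \<ge> 0" for k
  proof (rule restr_in_Conv_coe)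
    have "convex (C \<inter> {x. a \<bullet> x \<le> b + k})"
      using convex_C by (intro convex_Int convex_halfspace_le)
    then show "convex_on (C \<inter> {x. a \<bullet> x \<le> b + k}) g"
      using convex_on_subset[OF g] by blast
    show "\<exists>e. \<forall>x\<in>C \<inter> {x. a \<bullet> x \<le> b + k}. e \<le> norm x \<longrightarrow> r < g x" for r
      using coercive[of r] by blast
  qed (use that zC z closed_C continuous_on_subset[OF cont_g] in
      \<open>auto intro!: closed_Int closed_halfspace_le\<close>)
  have q_in: "?q k \<in> Conv_coe" and Zq: "Z (?q k) = Z (restr f K)" for k
    using Z_translate[OF f K, of "k *\<^sub>R d" "s * k"] by (simp_all add: q_def[abs_def] B_def)
  have B_ge: "b + k \<le> a \<bullet> x" if "x \<in> B k" for x k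
    using that nonneg ax unfolding B_def by fastforce
  have q_eq: "q k x = g x" and shift_P: "x - k *\<^sub>R d = P x"
    if "a \<bullet> x = b + k" "k \<ge> 0" for x k
    using that by (simp_all add: q_def g_def P_def)
  \<comment> \<open>The two domains overlap only on the hyperplane
    \<open>a \<bullet> x = b + k\<close>, where \<open>g\<close> and \<open>q k\<close> agree, so
    the minimum is the glued function.\<close>
  have m_eq: "?m k = restr (\<lambda>x. if a \<bullet> x \<le> b + k then g x else q k x)
      (C \<inter> {x. a \<bullet> x \<le> b + k} \<union> B k)" if "k \<ge> 0" for k
    using B_ge[of _ k] q_eq[of _ k] that by (fastforce simp: restr_def fun_eq_iff)
  have m_in: "?m k \<in> Conv_coe" if k: "k \<ge> 0" for k
  proof (rule min_in_Conv_coe[OF p_in[OF k] q_in])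
    have "convex_on (C \<inter> {x. a \<bullet> x \<le> b + k} \<union> B k) (\<lambda>x. if a \<bullet> x \<le> b + k then g x else q k x)"
    proof (rule convex_on_glue)
      show "convex_on C g" using g convex_C convex_on_subset by blast
      show "convex_on (B k) (q k)"
      proof -
        have "q k (u *\<^sub>R x + v *\<^sub>R y) \<le> u * q k x + v * q k y"
          if "0 \<le> u" "0 \<le> v" "u + v = 1" for u v x y
        proof -
          have "s * k = u * (s * k) + v * (s * k)" using that by (simp flip: distrib_right)
          moreover have "f (u *\<^sub>R x + v *\<^sub>R y - k *\<^sub>R d)
              \<le> u * f (x - k *\<^sub>R d) + v * f (y - k *\<^sub>R d)"
            using f that by (simp add: convex_combination_diff convex_on_def)
          ultimately show ?thesis unfolding q_def by (simp add: distrib_left)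
        qed
        moreover have "convex (B k)"
          unfolding convex_def B_def using K(2) by (auto simp: convex_combination_diff convexD)
        ultimately show ?thesis by (auto simp: convex_on_def)
      qed
      show "B k \<subseteq> C" 
      proof
        fix x assume "x \<in> B k"
        then have "P (x - k *\<^sub>R d) \<in> K" using proj by (simp add: B_def P_def)
        then show "x \<in> C" by (simp add: P_shift C_def)
      qed
      show "b + k \<le> a \<bullet> x" if "x \<in> B k" for x using that by (rule B_ge)
      show "g x \<le> q k x" if "x \<in> B k" for x
      proof -
        have "f (P (x - k *\<^sub>R d)) + s * (a \<bullet> x - k - b) \<le> f (x - k *\<^sub>R d)"
          using slope[of "x - k *\<^sub>R d"] that by (simp add: B_def P_def ax)
        then show ?thesis
          using B_ge[OF that] k by (simp add: P_shift q_def g_def right_diff_distrib)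
      qed
      show "x \<in> B k \<and> q k x = g x" if "x \<in> C" "a \<bullet> x = b + k" for x
        using that q_eq[of x k] shift_P[of x k] k by (simp add: B_def C_def)
    qed
    then show "ereal_convex (?m k)" unfolding m_eq[OF k] by (rule ereal_convex_restr)
  qed
  \<comment> \<open>The common domain is the face \<open>F\<close> shifted by \<open>k\<close> times
    \<open>d\<close>.\<close>
  have max_eq: "(\<lambda>x. max (?p k x) (?q k x)) = restr (q k) {x. x - k *\<^sub>R d \<in> F}"
    if k: "k \<ge> 0" for k
  proof -
    have "x \<in> C \<inter> {x. a \<bullet> x \<le> b + k} \<inter> B k \<longleftrightarrow> x - k *\<^sub>R d \<in> F" for x
      using B_ge[of x k] shift_P[of x k] k by (auto simp: B_def C_def F_def ax)
    moreover have "q k x = g x" if "x \<in> C \<inter> {x. a \<bullet> x \<le> b + k} \<inter> B k" for x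
      using that B_ge[of x k] q_eq[of x k] k by auto
    ultimately show ?thesis by (auto simp: restr_def fun_eq_iff)
  qed
  have val: "Z (restr f F) + Z (?m k) = Z (?p k) + Z (restr f K)" if k: "k \<ge> 0" for k
  proof -
    have "restr (q k) {x. x - k *\<^sub>R d \<in> F} \<in> Conv_coe"
      "Z (restr (q k) {x. x - k *\<^sub>R d \<in> F}) = Z (restr f F)"
      using Z_translate[OF f F, of "k *\<^sub>R d" "s * k"] by (simp_all add: q_def[abs_def])
    moreover from this(1) have "Z (\<lambda>x. max (?p k x) (?q k x)) + Z (?m k) = Z (?p k) + Z (?q k)"
      by (intro Z_valuation p_in[OF k] q_in m_in[OF k]) (simp add: max_eq[OF k])
    ultimately show ?thesis by (simp add: max_eq[OF k] Zq)
  qed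
  \<comment> \<open>The gluing hyperplane escapes to infinity, so locally nothing changes for large \<open>k\<close>.\<close>
  have far: "\<forall>\<^sub>F k in sequentially. a \<bullet> X k < b + real k" if "X \<longlonglongrightarrow> x" for X x
  proof -
    have "(\<lambda>k. a \<bullet> X k) \<longlonglongrightarrow> a \<bullet> x" using that by (intro tendsto_intros)
    then have "\<forall>\<^sub>F k in sequentially. a \<bullet> X k < a \<bullet> x + 1" by (rule order_tendstoD) simp
    moreover have "\<forall>\<^sub>F k in sequentially. a \<bullet> x + 1 - b < real k"
      using filterlim_real_sequentially by (simp add: filterlim_at_top_dense)
    ultimately show ?thesis by eventually_elim simp
  qed
  have lsc: "lower_semicontinuous (restr g C)"
    using g_in by (simp add: Conv_coe_def Conv_def)
  have "epi_converges (\<lambda>k. ?p (real k)) (restr g C)"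
  proof (rule epi_converges_eventually_eq[OF lsc])
    fix x and X :: "nat \<Rightarrow> 'a" assume "X \<longlonglongrightarrow> x"
    from far[OF this] show "\<forall>\<^sub>F k in sequentially. ?p (real k) (X k) = restr g C (X k)"
      by eventually_elim (simp add: restr_def)
  qed
  then have lim_p: "(\<lambda>k. Z (?p (real k))) \<longlonglongrightarrow> Z (restr g C)"
    by (intro Z_tendsto p_in g_in) auto
  have "epi_converges (\<lambda>k. ?m (real k)) (restr g C)"
  proof (rule epi_converges_eventually_eq[OF lsc])
    fix x and X :: "nat \<Rightarrow> 'a" assume "X \<longlonglongrightarrow> x"
    from far[OF this] show "\<forall>\<^sub>F k in sequentially. ?m (real k) (X k) = restr g C (X k)"
    proof eventually_elim
      case (elim k)
      then have "X k \<notin> B (real k)" using B_ge by fastforce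
      then show ?case using elim by (simp add: restr_def)
    qed
  qed
  then have "(\<lambda>k. Z (?m (real k))) \<longlonglongrightarrow> Z (restr g C)"
    by (intro Z_tendsto m_in g_in) auto
  then have lim_m: "(\<lambda>k. Z (restr f F) + Z (?m (real k))) \<longlonglongrightarrow> Z (restr f F) + Z (restr g C)"
    by (intro tendsto_intros)
  have lim_p': "(\<lambda>k. Z (?p (real k)) + Z (restr f K)) \<longlonglongrightarrow> Z (restr g C) + Z (restr f K)"
    using lim_p by (intro tendsto_intros)
  have "Z (restr f F) + Z (?m (real k)) = Z (?p (real k)) + Z (restr f K)" for k
    by (rule val) simp
  then have "(\<lambda>k. Z (?p (real k)) + Z (restr f K)) \<longlonglongrightarrow> Z (restr f F) + Z (restr g C)"
    using lim_m by (simp only:)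
  from LIMSEQ_unique[OF this lim_p'] have "Z (restr f F) = Z (restr f K)" by simp
  then show ?thesis by (simp add: F_def)
qed

end

section \<open>Affine hulls, successive cuts and maxima of convex functions\<close>

text \<open>Serves to show that a section by a hyperplane not containing the whole set has smaller
  dimension.\<close>

lemma affine_hull_eq_if_aff_dim_le:
  fixes S T :: "'a::euclidean_space set"
  assumes "S \<subseteq> T" "\<not> aff_dim S < aff_dim T"
  shows "affine hull S = affine hull T"
  using assms aff_dim_psubset hull_mono by blast

text \<open>Successive cuts along the sets \<open>h i = h j\<close> decompose a set into pieces on each of which a
  single \<open>h i\<close> is maximal.\<close>

lemma cut_by_maximal_function:
  fixes h :: "'i \<Rightarrow> 'a \<Rightarrow> real"
  assumes "finite I" "I \<noteq> {}"
    and closed: "\<And>L i j. R L \<Longrightarrow> i \<in> I \<Longrightarrow> j \<in> I \<Longrightarrow> R (L \<inter> {x. h i x \<le> h j x})"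
    and cut: "\<And>L i j. R L \<Longrightarrow> i \<in> I \<Longrightarrow> j \<in> I \<Longrightarrow> Q (L \<inter> {x. h i x \<le> h j x}) \<Longrightarrow>
        Q (L \<inter> {x. h j x \<le> h i x}) \<Longrightarrow> Q L"
    and piece: "\<And>L i. R L \<Longrightarrow> i \<in> I \<Longrightarrow> (\<And>x j. x \<in> L \<Longrightarrow> j \<in> I \<Longrightarrow> h j x \<le> h i x) \<Longrightarrow> Q L"
    and "R L"
  shows "Q L"
proof -
  have "Q L" if "finite J" "J \<noteq> {}" "J \<subseteq> I" "R L"
    and "\<And>L i. R L \<Longrightarrow> i \<in> J \<Longrightarrow> (\<And>x j. x \<in> L \<Longrightarrow> j \<in> J \<Longrightarrow> h j x \<le> h i x) \<Longrightarrow> Q L" for J L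
    using that
  proof (induction arbitrary: L rule: finite_ne_induct)
    case (singleton i)
    then show ?case by blast
  next
    case (insert i J)
    \<comment> \<open>A set on which \<open>h j\<close> is largest over \<open>J\<close> is cut by
      comparing \<open>h j\<close> with \<open>h i\<close>; by transitivity, \<open>h i\<close>
      dominates all of \<open>J\<close> on the half where it exceeds \<open>h j\<close>.\<close>
    show ?case
    proof (rule insert.IH)
      fix L j assume L: "R L" and j: "j \<in> J" and dom: "\<And>x k. x \<in> L \<Longrightarrow> k \<in> J \<Longrightarrow> h k x \<le> h j x"
      have ij: "i \<in> I" "j \<in> I" using j insert.prems by auto
      show "Q L"
      proof (rule cut[OF L ij])
        show "Q (L \<inter> {x. h i x \<le> h j x})"
          by (rule insert.prems(3)[of _ j]) (use closed[OF L ij] j dom in auto)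
        show "Q (L \<inter> {x. h j x \<le> h i x})"
          by (rule insert.prems(3)[of _ i])
            (use closed[OF L ij(2,1)] dom in \<open>auto intro: order_trans\<close>)
      qed
    qed (use insert.prems in auto)
  qed
  from this[of I L] show ?thesis using assms by blast
qed

lemma convex_on_affine: "convex_on UNIV (\<lambda>x. p \<bullet> x + (q::real))"
  unfolding convex_on_def
proof (intro conjI ballI allI impI)
  fix x y and u v :: real assume "u + v = 1"
  then have "q = u * q + v * q" by (simp flip: distrib_right)
  then show "p \<bullet> (u *\<^sub>R x + v *\<^sub>R y) + q \<le> u * (p \<bullet> x + q) + v * (p \<bullet> y + q)"
    by (simp add: inner_simps distrib_left)
qed simp

lemma convex_on_Max:
  assumes "finite I" "I \<noteq> {}" and h: "\<And>i. i \<in> I \<Longrightarrow> convex_on S (h i)"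
  shows "convex_on S (\<lambda>x. Max ((\<lambda>i. h i x) ` I))"
  unfolding convex_on_def
proof (intro conjI ballI allI impI)
  show "convex S" using assms convex_on_imp_convex by blast
  fix x y and u v :: real
  assume *: "x \<in> S" "y \<in> S" "0 \<le> u" "0 \<le> v" "u + v = 1"
  show "Max ((\<lambda>i. h i (u *\<^sub>R x + v *\<^sub>R y)) ` I)
      \<le> u * Max ((\<lambda>i. h i x) ` I) + v * Max ((\<lambda>i. h i y) ` I)"
  proof (rule Max.boundedI)
    fix r assume "r \<in> (\<lambda>i. h i (u *\<^sub>R x + v *\<^sub>R y)) ` I"
    then obtain i where i: "i \<in> I" and r: "r = h i (u *\<^sub>R x + v *\<^sub>R y)" by auto
    have "r \<le> u * h i x + v * h i y"
      using h[OF i] * by (simp add: r convex_on_def)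
    also have "\<dots> \<le> u * Max ((\<lambda>i. h i x) ` I) + v * Max ((\<lambda>i. h i y) ` I)"
      using i assms(1) * by (intro add_mono mult_left_mono Max_ge) auto
    finally show "r \<le> \<dots>" .
  qed (use assms in auto)
qed

section \<open>Affine functions and their maxima on polytopes\<close>

context epi_invariant_valuation
begin

text \<open>Adding a small multiple of \<open>a \<bullet> x - b\<close> gives the strict slope
  required by \<open>Z_project_to_face_strict\<close>. The added term vanishes on the face, and the
  perturbed functions epi-converge to the original one.\<close>

lemma Z_project_to_face:
  fixes d :: 'a
  assumes f: "convex_on UNIV f" and K: "compact K" "convex K" "K \<noteq> {}"
    and ad: "a \<bullet> d = 1"
    and nonneg: "\<And>x. x \<in> K \<Longrightarrow> b \<le> a \<bullet> x"
    and proj: "\<And>x. x \<in> K \<Longrightarrow> x - (a \<bullet> x - b) *\<^sub>R d \<in> K"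
    and mono: "\<And>x. x \<in> K \<Longrightarrow> f (x - (a \<bullet> x - b) *\<^sub>R d) \<le> f x"
  shows "Z (restr f K) = Z (restr f (K \<inter> {x. a \<bullet> x = b}))"
proof -
  define F where "F k x = f x + (1 / real (Suc k)) * (a \<bullet> x + (- b))" for k x
  have F: "convex_on UNIV (F k)" for k
    unfolding F_def by (intro convex_on_add f convex_on_cmul convex_on_affine) auto
  have "Z (restr (F k) K) = Z (restr (F k) (K \<inter> {x. a \<bullet> x = b}))" for k
  proof (rule Z_project_to_face_strict[OF F K ad, where s = "1 / real (Suc k)"])
    show "F k (x - (a \<bullet> x - b) *\<^sub>R d) + 1 / real (Suc k) * (a \<bullet> x - b) \<le> F k x" if "x \<in> K" for x
      using mono[OF that] by (simp add: F_def inner_simps ad)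
  qed (use nonneg proj in auto)
  moreover have "restr (F k) (K \<inter> {x. a \<bullet> x = b}) = restr f (K \<inter> {x. a \<bullet> x = b})" for k
    by (auto simp: restr_def F_def fun_eq_iff)
  ultimately have "Z (restr (F k) K) = Z (restr f (K \<inter> {x. a \<bullet> x = b}))" for k by simp
  moreover have "(\<lambda>k. Z (restr (F k) K)) \<longlonglongrightarrow> Z (restr f K)"
  proof (rule Z_tendsto)
    show "epi_converges (\<lambda>k. restr (F k) K) (restr f K)"
    proof (rule epi_converges_restr)
      fix x and X :: "nat \<Rightarrow> 'a" assume X: "X \<longlonglongrightarrow> x"
      have "continuous_on UNIV f" using f convex_on_continuous by blast
      then have "(\<lambda>k. f (X k)) \<longlonglongrightarrow> f x"
        using X by (metis UNIV_I continuous_on_tendsto_compose eventually_sequentiallyI)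
      moreover have "(\<lambda>k. 1 / real (Suc k)) \<longlonglongrightarrow> 0" by (rule LIMSEQ_Suc[OF lim_1_over_n])
      ultimately have "(\<lambda>k. F k (X k)) \<longlonglongrightarrow> f x + 0 * (a \<bullet> x + (- b))"
        unfolding F_def using X by (intro tendsto_intros)
      then show "(\<lambda>k. F k (X k)) \<longlonglongrightarrow> f x" by simp
    qed (use K in \<open>simp add: compact_imp_closed\<close>)
  qed (use f F K restr_compact_in_Conv_coe in auto)
  ultimately show ?thesis by (simp add: LIMSEQ_const_iff)
qed

text \<open>The value at the indicator function of the origin, the constant to which
  \<open>Z\<close> will be shown equal.\<close>

definition Z0 :: real where "Z0 = Z (restr (\<lambda>_. 0) {0})"

lemma Z_singleton: "Z (restr f {x}) = Z0"
proof -
  have "restr f {x} = restr (\<lambda>y. 0 + f x) {y. y - x \<in> {0}}"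
    by (auto simp: restr_def fun_eq_iff)
  then show ?thesis
    using Z_translate(2)[of "\<lambda>_. 0" "{0}" x "f x"] by (simp add: Z0_def convex_on_const)
qed

text \<open>Unless one half is all of \<open>L\<close>, the section has smaller dimension than
  \<open>L\<close>, hence than the ambient \<open>K\<close>, and \<open>IH\<close> gives its value;
  the valuation identity then determines \<open>Z\<close> on \<open>L\<close>. Allowing empty sets
  lets the cuts be iterated without tracking nonemptiness.\<close>

lemma Z_polytope_cut:
  assumes f: "convex_on UNIV f"
    and IH: "\<And>L. polytope L \<Longrightarrow> L \<noteq> {} \<Longrightarrow> L \<subseteq> K \<Longrightarrow> aff_dim L < aff_dim K \<Longrightarrow> Z (restr f L) = Z0"
    and L: "polytope L" "L \<subseteq> K"
    and le: "L \<inter> {x. a \<bullet> x \<le> b} = {} \<or> Z (restr f (L \<inter> {x. a \<bullet> x \<le> b})) = Z0"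
    and ge: "L \<inter> {x. a \<bullet> x \<ge> b} = {} \<or> Z (restr f (L \<inter> {x. a \<bullet> x \<ge> b})) = Z0"
  shows "L = {} \<or> Z (restr f L) = Z0"
proof -
  let ?E = "L \<inter> {x. a \<bullet> x = b}"
  consider "L \<inter> {x. a \<bullet> x \<le> b} = {}" | "L \<inter> {x. a \<bullet> x \<ge> b} = {}" | "L \<subseteq> {x. a \<bullet> x = b}"
    | "L \<inter> {x. a \<bullet> x \<le> b} \<noteq> {}" "L \<inter> {x. a \<bullet> x \<ge> b} \<noteq> {}" "\<not> L \<subseteq> {x. a \<bullet> x = b}"
    by blast
  then show ?thesis
  proof cases
    case 1
    then have "L \<inter> {x. a \<bullet> x \<ge> b} = L" by force
    then show ?thesis using ge by simp
  next
    case 2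
    then have "L \<inter> {x. a \<bullet> x \<le> b} = L" by force
    then show ?thesis using le by simp
  next
    case 3
    then have "L \<inter> {x. a \<bullet> x \<le> b} = L" by force
    then show ?thesis using le by simp
  next
    case 4
    obtain x y where "x \<in> L" "y \<in> L" "a \<bullet> x \<le> b" "b \<le> a \<bullet> y" using 4 by auto
    then have ne: "?E \<noteq> {}"
      using connected_ivt_hyperplane[OF convex_connected[OF polytope_imp_convex[OF L(1)]]] by blast
    have "polytope ?E" using L(1) by (intro polytope_Int_polyhedron polyhedron_hyperplane)
    moreover have "aff_dim ?E < aff_dim K"
    proof (rule ccontr)
      assume "\<not> aff_dim ?E < aff_dim K"
      then have "\<not> aff_dim ?E < aff_dim L" using aff_dim_subset[OF L(2)] by linarith
      then have "affine hull ?E = affine hull L" by (intro affine_hull_eq_if_aff_dim_le) auto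
      moreover have "affine hull ?E \<subseteq> {x. a \<bullet> x = b}"
        by (intro hull_minimal affine_hyperplane) auto
      ultimately show False using 4(3) hull_subset[of L affine] by auto
    qed
    ultimately have "Z (restr f ?E) = Z0" using IH ne L(2) by (meson inf.coboundedI1)
    then show ?thesis
      using Z_hyperplane_cut[OF f polytope_imp_compact[OF L(1)] polytope_imp_convex[OF L(1)] 4(1,2)]
        le ge 4 by auto
  qed
qed

text \<open>Each piece consists of points whose backward line along \<open>d\<close> first meets one
  fixed bounding hyperplane. Projecting along \<open>d\<close> onto that hyperplane stays in the
  piece and does not increase \<open>f\<close>, so \<open>Z_project_to_face\<close> replaces the
  piece by a section of smaller dimension, covered by \<open>IH\<close>.\<close>

lemma Z_affine_step:
  fixes p :: 'a and q :: real
  defines "f \<equiv> \<lambda>x. p \<bullet> x + q"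
  assumes K: "polytope K" "K \<noteq> {}"
    and IH: "\<And>L. polytope L \<Longrightarrow> L \<noteq> {} \<Longrightarrow> L \<subseteq> K \<Longrightarrow> aff_dim L < aff_dim K \<Longrightarrow> Z (restr f L) = Z0"
  shows "Z (restr f K) = Z0"
proof (cases "\<exists>x. K = {x}")
  case True
  then show ?thesis using Z_singleton by auto
next
  case False
  have f: "convex_on UNIV f" unfolding f_def by (rule convex_on_affine)
  obtain x0 where "x0 \<in> K" using K(2) by blast
  moreover obtain y0 where "y0 \<in> K" "x0 \<noteq> y0" using False \<open>x0 \<in> K\<close> by auto
  \<comment> \<open>Two distinct points of \<open>K\<close>, ordered so that \<open>f\<close> does
    not decrease from \<open>x1\<close> to \<open>y1\<close>; their difference is a direction inside
    the affine hull of \<open>K\<close>.\<close>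
  ultimately obtain x1 y1 where xy: "x1 \<in> K" "y1 \<in> K" "x1 \<noteq> y1" "p \<bullet> x1 \<le> p \<bullet> y1"
    by (metis linear)
  define d where "d = y1 - x1"
  have d: "d \<noteq> 0" "p \<bullet> d \<ge> 0" using xy by (auto simp: d_def inner_simps)
  have "polyhedron K" "bounded K" using K(1) polytope_eq_bounded_polyhedron by blast+
  then obtain H where H: "finite H" "K = \<Inter> H" "\<forall>h\<in>H. \<exists>a b. a \<noteq> 0 \<and> h = {x. a \<bullet> x \<le> b}"
    unfolding polyhedron_def by blast
  from H(3) obtain a b where ab: "\<And>h. h \<in> H \<Longrightarrow> h = {x. a h \<bullet> x \<le> b h}" by metis
  have in_K: "x \<in> K \<longleftrightarrow> (\<forall>h\<in>H. a h \<bullet> x \<le> b h)" for x using H(2) ab by blast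
  define I where "I = {h \<in> H. a h \<bullet> d < 0}"
  \<comment> \<open>Going backwards along \<open>d\<close> from \<open>x\<close>, the facet \<open>h \<in> I\<close> is reached at time \<open>\<alpha> h \<bullet> x - \<beta> h\<close>.\<close>
  define \<alpha> where "\<alpha> h = (1 / (a h \<bullet> d)) *\<^sub>R a h" for h
  define \<beta> where "\<beta> h = b h / (a h \<bullet> d)" for h
  have \<alpha>d: "\<alpha> h \<bullet> d = 1" if "h \<in> I" for h using that by (simp add: \<alpha>_def I_def)
  have entry: "a h \<bullet> x \<le> b h \<longleftrightarrow> \<beta> h \<le> \<alpha> h \<bullet> x" if "h \<in> I" for h x
    using that by (simp add: \<alpha>_def \<beta>_def I_def divide_right_mono_neg divide_le_cancel)
  \<comment> \<open>Otherwise no bounding hyperplane would stop a backward motion along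
    \<open>d\<close>, and \<open>K\<close> would contain a ray. The time \<open>t\<close> below is
    long enough to leave the ball of radius \<open>r\<close>.\<close>
  have "I \<noteq> {}"
  proof
    assume "I = {}"
    obtain r where r: "\<And>x. x \<in> K \<Longrightarrow> norm x \<le> r" using \<open>bounded K\<close> bounded_iff by blast
    define t where "t = (r + norm x1 + 1) / norm d"
    have "0 \<le> r" using r[OF xy(1)] norm_ge_zero order_trans by blast
    then have t: "t \<ge> 0" by (simp add: t_def)
    have "x1 - t *\<^sub>R d \<in> K"
      unfolding in_K
    proof
      fix h assume h: "h \<in> H"
      then have "0 \<le> t * (a h \<bullet> d)" using \<open>I = {}\<close> t by (auto simp: I_def not_less)
      moreover have "a h \<bullet> x1 \<le> b h" using xy(1) h in_K by blast
      ultimately show "a h \<bullet> (x1 - t *\<^sub>R d) \<le> b h" by (simp add: inner_simps)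
    qed
    then have "norm (x1 - t *\<^sub>R d) \<le> r" by (rule r)
    moreover have "norm (t *\<^sub>R d) = t * norm d" using t by simp
    moreover have "t * norm d = r + norm x1 + 1" using d by (simp add: t_def)
    moreover have "norm (t *\<^sub>R d) \<le> norm x1 + norm (x1 - t *\<^sub>R d)"
      using norm_triangle_ineq4[of x1 "x1 - t *\<^sub>R d"] by simp
    ultimately show False by linarith
  qed
  \<comment> \<open>The pieces must be cut parallel to \<open>d\<close>, so that no new entry facets arise.\<close>
  define R where "R L \<longleftrightarrow> polytope L \<and> L \<subseteq> K \<and> (\<forall>x\<in>L. \<forall>t. x + t *\<^sub>R d \<in> K \<longrightarrow> x + t *\<^sub>R d \<in> L)" for L
  define Q where "Q L \<longleftrightarrow> L = {} \<or> Z (restr f L) = Z0" for L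
  \<comment> \<open>Comparing two entry times is a halfspace condition, as needed for
    \<open>Z_polytope_cut\<close>.\<close>
  have half: "{x. \<beta> i - \<alpha> i \<bullet> x \<le> \<beta> j - \<alpha> j \<bullet> x} = {x. (\<alpha> j - \<alpha> i) \<bullet> x \<le> \<beta> j - \<beta> i}"
    "{x. \<beta> j - \<alpha> j \<bullet> x \<le> \<beta> i - \<alpha> i \<bullet> x} = {x. \<beta> j - \<beta> i \<le> (\<alpha> j - \<alpha> i) \<bullet> x}" for i j
    by (auto simp: inner_simps)
  \<comment> \<open>The functions compared are the negatives of the backward times, so the maximal
    one belongs to the hyperplane reached first.\<close>
  have "Q K"
  proof (rule cut_by_maximal_function[where h = "\<lambda>h x. \<beta> h - \<alpha> h \<bullet> x" and I = I and R = R])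
    show "finite I" using H(1) by (simp add: I_def)
    show "I \<noteq> {}" by fact
    show "R K" using K by (simp add: R_def)
    show "R (L \<inter> {x. \<beta> i - \<alpha> i \<bullet> x \<le> \<beta> j - \<alpha> j \<bullet> x})" if "R L" "i \<in> I" "j \<in> I" for L i j
    proof -
      have "polytope (L \<inter> {x. \<beta> i - \<alpha> i \<bullet> x \<le> \<beta> j - \<alpha> j \<bullet> x})"
        unfolding half using that(1)
        by (intro polytope_Int_polyhedron polyhedron_halfspace_le) (simp add: R_def)
      \<comment> \<open>Both \<open>\<alpha> i\<close> and \<open>\<alpha> j\<close> have inner
        product 1 with \<open>d\<close>, so the cutting condition is constant along
        \<open>d\<close>.\<close>
      then show ?thesis using that by (auto simp: R_def inner_simps \<alpha>d)
    qed
    show "Q L" if "R L" "Q (L \<inter> {x. \<beta> i - \<alpha> i \<bullet> x \<le> \<beta> j - \<alpha> j \<bullet> x})"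
      "Q (L \<inter> {x. \<beta> j - \<alpha> j \<bullet> x \<le> \<beta> i - \<alpha> i \<bullet> x})" for L i j
      unfolding Q_def
    proof (rule Z_polytope_cut[OF f])
      show "polytope L" "L \<subseteq> K" using that(1) by (simp_all add: R_def)
    qed (use IH that(2,3) in \<open>simp_all only: half[where i = i and j = j] Q_def\<close>)
  next
    fix L i assume L: "R L" and i: "i \<in> I"
      and max: "\<And>x j. x \<in> L \<Longrightarrow> j \<in> I \<Longrightarrow> \<beta> j - \<alpha> j \<bullet> x \<le> \<beta> i - \<alpha> i \<bullet> x"
    have LK: "polytope L" "L \<subseteq> K" using L by (auto simp: R_def)
    let ?E = "L \<inter> {x. \<alpha> i \<bullet> x = \<beta> i}"
    have entry_L: "\<beta> i \<le> \<alpha> i \<bullet> x" if "x \<in> L" for x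
      using that LK(2) in_K entry[OF i] i by (auto simp: I_def)
    \<comment> \<open>Halfspaces in \<open>I\<close> are not left because \<open>i\<close> is
      reached first; for the others, moving backwards cannot increase
      \<open>a h \<bullet> x\<close>. As \<open>L\<close> contains every point of \<open>K\<close>
      on its lines along \<open>d\<close>, the projection lies in \<open>L\<close>.\<close>
    have proj: "x - (\<alpha> i \<bullet> x - \<beta> i) *\<^sub>R d \<in> L" if x: "x \<in> L" for x
    proof -
      have "x - (\<alpha> i \<bullet> x - \<beta> i) *\<^sub>R d \<in> K"
        unfolding in_K
      proof
        fix h assume h: "h \<in> H"
        show "a h \<bullet> (x - (\<alpha> i \<bullet> x - \<beta> i) *\<^sub>R d) \<le> b h"
        proof (cases "h \<in> I")
          case True
          then show ?thesis
            unfolding entry[OF True] using max[OF x True] by (simp add: inner_simps \<alpha>d)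
        next
          case False
          then have "0 \<le> (\<alpha> i \<bullet> x - \<beta> i) * (a h \<bullet> d)"
            using h entry_L[OF x] by (auto simp: I_def not_less)
          moreover have "a h \<bullet> x \<le> b h" using x LK(2) h in_K by blast
          ultimately show ?thesis by (simp add: inner_simps)
        qed
      qed
      moreover have "x - (\<alpha> i \<bullet> x - \<beta> i) *\<^sub>R d = x + (- (\<alpha> i \<bullet> x - \<beta> i)) *\<^sub>R d"
        by (metis diff_conv_add_uminus scaleR_minus_left)
      ultimately show ?thesis using L x unfolding R_def by metis
    qed
    show "Q L"
    proof (cases "L = {} \<or> aff_dim L < aff_dim K")
      case True
      then show ?thesis using IH LK by (auto simp: Q_def)
    next
      case ne: False
      have "Z (restr f L) = Z (restr f ?E)"
      proof (rule Z_project_to_face[OF f])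
        show "f (x - (\<alpha> i \<bullet> x - \<beta> i) *\<^sub>R d) \<le> f x" if "x \<in> L" for x
          using entry_L[OF that] d(2) by (simp add: f_def inner_simps)
      qed (use ne LK \<alpha>d[OF i] entry_L proj in \<open>auto simp: polytope_imp_compact polytope_imp_convex\<close>)
      moreover have "?E \<noteq> {}"
      proof -
        obtain x where "x \<in> L" using ne by auto
        then have "x - (\<alpha> i \<bullet> x - \<beta> i) *\<^sub>R d \<in> ?E"
          using proj by (simp add: inner_simps \<alpha>d[OF i])
        then show ?thesis by blast
      qed
      moreover have "polytope ?E"
        using LK by (intro polytope_Int_polyhedron polyhedron_hyperplane)
      \<comment> \<open>The hyperplane is transversal to \<open>d = y1 - x1\<close>, so it cannot
        contain both \<open>x1\<close> and \<open>y1\<close>.\<close>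
      moreover have "aff_dim ?E < aff_dim K"
      proof (rule ccontr)
        assume "\<not> aff_dim ?E < aff_dim K"
        then have "affine hull ?E = affine hull K"
          using LK by (intro affine_hull_eq_if_aff_dim_le) auto
        moreover have "affine hull ?E \<subseteq> {x. \<alpha> i \<bullet> x = \<beta> i}"
          by (intro hull_minimal affine_hyperplane) auto
        ultimately have "\<alpha> i \<bullet> x1 = \<beta> i" "\<alpha> i \<bullet> y1 = \<beta> i"
          using xy hull_subset[of K affine] by auto
        then show False using \<alpha>d[OF i] by (simp add: d_def inner_simps)
      qed
      ultimately show ?thesis using IH[of ?E] LK by (auto simp: Q_def)
    qed
  qed
  then show ?thesis using K by (simp add: Q_def)
qed

lemma Z_affine:
  assumes "polytope K" "K \<noteq> {}"
  shows "Z (restr (\<lambda>x. p \<bullet> x + q) K) = Z0"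
  using assms
\<comment> \<open>The dimension of the empty set is -1, so the shift by 1 keeps the measure faithful
  under \<open>nat\<close>.\<close>
proof (induction "nat (aff_dim K + 1)" arbitrary: K rule: less_induct)
  case less
  show ?case
  proof (rule Z_affine_step[OF less.prems])
    fix L :: "'a set" assume L: "polytope L" "L \<noteq> {}" "aff_dim L < aff_dim K"
    then have "nat (aff_dim L + 1) < nat (aff_dim K + 1)" using aff_dim_geq[of L] by linarith
    then show "Z (restr (\<lambda>x. p \<bullet> x + q) L) = Z0" using less.hyps L by blast
  qed
qed

text \<open>Cutting along the sets where two of the affine functions agree leaves pieces on which
  the maximum is a single affine function, settled by \<open>Z_affine\<close>. Induction on the
  dimension supplies the values on the sections.\<close>

lemma Z_Max_affine:
  assumes "polytope K" "K \<noteq> {}" and I: "finite I" "I \<noteq> {}"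
  shows "Z (restr (\<lambda>x. Max ((\<lambda>i. p i \<bullet> x + q i) ` I)) K) = Z0"
  using assms(1,2)
proof (induction "nat (aff_dim K + 1)" arbitrary: K rule: less_induct)
  case less
  let ?f = "\<lambda>x. Max ((\<lambda>i. p i \<bullet> x + q i) ` I)"
  have dim: "nat (aff_dim L + 1) < nat (aff_dim K + 1)" if "aff_dim L < aff_dim K" for L :: "'a set"
    using that aff_dim_geq[of L] by linarith
  have f: "convex_on UNIV ?f" using I by (intro convex_on_Max convex_on_affine)
  have half: "{x. p i \<bullet> x + q i \<le> p j \<bullet> x + q j} = {x. (p i - p j) \<bullet> x \<le> q j - q i}"
    "{x. p j \<bullet> x + q j \<le> p i \<bullet> x + q i} = {x. q j - q i \<le> (p i - p j) \<bullet> x}" for i j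
    by (auto simp: inner_simps)
  have "K = {} \<or> Z (restr ?f K) = Z0"
  proof (rule cut_by_maximal_function[where h = "\<lambda>i x. p i \<bullet> x + q i" and I = I
        and R = "\<lambda>L. polytope L \<and> L \<subseteq> K" and Q = "\<lambda>L. L = {} \<or> Z (restr ?f L) = Z0"])
    show "polytope (L \<inter> {x. p i \<bullet> x + q i \<le> p j \<bullet> x + q j}) \<and> L \<inter> {x. p i \<bullet> x + q i \<le> p j \<bullet> x + q j} \<subseteq> K"
      if "polytope L \<and> L \<subseteq> K" for L i j
      unfolding half using that by (auto intro: polytope_Int_polyhedron polyhedron_halfspace_le)
    show "L = {} \<or> Z (restr ?f L) = Z0" if "polytope L \<and> L \<subseteq> K"
      "L \<inter> {x. p i \<bullet> x + q i \<le> p j \<bullet> x + q j} = {} \<or>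
        Z (restr ?f (L \<inter> {x. p i \<bullet> x + q i \<le> p j \<bullet> x + q j})) = Z0"
      "L \<inter> {x. p j \<bullet> x + q j \<le> p i \<bullet> x + q i} = {} \<or>
        Z (restr ?f (L \<inter> {x. p j \<bullet> x + q j \<le> p i \<bullet> x + q i})) = Z0" for L i j
    proof (rule Z_polytope_cut[OF f])
      show "Z (restr ?f L) = Z0" if "polytope L" "L \<noteq> {}" "L \<subseteq> K" "aff_dim L < aff_dim K" for L
        using less.hyps[OF dim] that by blast
    qed (use that in \<open>simp_all only: half[where i = i and j = j]\<close>)
    show "L = {} \<or> Z (restr ?f L) = Z0" if L: "polytope L \<and> L \<subseteq> K" and i: "i \<in> I"
      and max: "\<And>x j. x \<in> L \<Longrightarrow> j \<in> I \<Longrightarrow> p j \<bullet> x + q j \<le> p i \<bullet> x + q i" for L i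
    proof -
      have "?f x = p i \<bullet> x + q i" if "x \<in> L" for x
        using I i max[OF that] by (intro Max_eqI) auto
      then have "restr ?f L = restr (\<lambda>x. p i \<bullet> x + q i) L"
        by (auto simp: restr_def fun_eq_iff)
      then show ?thesis using L Z_affine[of L] by metis
    qed
    show "polytope K \<and> K \<subseteq> K" using less.prems by simp
  qed fact+
  then show ?case using less.prems by simp
qed

end

section \<open>Epigraphs as countable intersections of halfspaces\<close>

lemma closed_epigraph:
  fixes v :: "'a::topological_space \<Rightarrow> ereal"
  assumes "lower_semicontinuous v"
  shows "closed {(x, t). v x \<le> ereal t}"
  unfolding closed_def
proof (rule open_prod_intro)
  fix z assume "z \<in> - {(x, t). v x \<le> ereal t}"
  then obtain x t where z: "z = (x, t)" and "ereal t < v x" by (cases z) auto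
  then obtain r where r: "ereal t < ereal r" "ereal r < v x" using ereal_dense2 by blast
  obtain S where S: "open S" "x \<in> S" "\<forall>y\<in>S. ereal r < v y"
    using lower_semicontinuous_nhds[OF assms r(2)] by (auto simp: eventually_nhds)
  have "\<not> v y \<le> ereal s" if "y \<in> S" "s < r" for y s
  proof -
    have "ereal s < ereal r" using that(2) by simp
    also have "ereal r < v y" using S(3) that(1) by blast
    finally show ?thesis by simp
  qed
  then have box: "z \<in> S \<times> {..<r}" "S \<times> {..<r} \<subseteq> - {(x, t). v x \<le> ereal t}"
    using S(2) z r(1) by auto
  show "\<exists>A B. open A \<and> open B \<and> z \<in> A \<times> B \<and> A \<times> B \<subseteq> - {(x, t). v x \<le> ereal t}"
    by (intro exI[of _ S] exI[of _ "{..<r}"] conjI S(1) open_lessThan box)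
qed

lemma convex_epigraph:
  assumes "ereal_convex v"
  shows "convex {(x, t). v x \<le> ereal t}"
  unfolding convex_def
proof (intro ballI allI impI)
  fix z w and s t :: real
  assume z: "z \<in> {(x, t). v x \<le> ereal t}" and w: "w \<in> {(x, t). v x \<le> ereal t}"
    and st: "0 \<le> s" "0 \<le> t" "s + t = 1"
  obtain x r y l where eq: "z = (x, r)" "w = (y, l)" by (metis surj_pair)
  have "v (s *\<^sub>R x + t *\<^sub>R y) \<le> ereal s * v x + ereal t * v y"
    using assms st by (simp add: ereal_convex_def)
  also have "\<dots> \<le> ereal s * ereal r + ereal t * ereal l"
    using z w st by (intro add_mono ereal_mult_left_mono) (auto simp: eq)
  finally show "s *\<^sub>R z + t *\<^sub>R w \<in> {(x, t). v x \<le> ereal t}" by (simp add: eq)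
qed

text \<open>By separation, the open halfspaces missing the closed convex epigraph cover its
  complement, and the Lindelof property extracts countably many. The coefficient of \<open>t\<close>
  is nonnegative because the epigraph contains an upward ray.\<close>

lemma epigraph_eq_countable_Inter_halfspaces:
  fixes v :: "'a::euclidean_space \<Rightarrow> ereal"
  assumes "v \<in> Conv"
  obtains p :: "nat \<Rightarrow> 'a" and q b :: "nat \<Rightarrow> real"
  where "\<And>i. q i \<ge> 0" and "\<And>x t. v x \<le> ereal t \<longleftrightarrow> (\<forall>i. b i \<le> p i \<bullet> x + q i * t)"
proof -
  let ?E = "{(x, t). v x \<le> ereal t}"
  have v: "\<And>x. v x \<noteq> -\<infinity>" "\<exists>x. v x \<noteq> \<infinity>" "ereal_convex v" "lower_semicontinuous v"
    using assms by (auto simp: Conv_def)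
  obtain x0 r0 where x0: "v x0 = ereal r0" using v(1,2) by (metis ereal_cases)
  define \<F> where "\<F> = {{z. a \<bullet> z < c} | (a :: 'a \<times> real) c. \<forall>w\<in>?E. c \<le> a \<bullet> w}"
  have "open S" if "S \<in> \<F>" for S using that by (auto simp: \<F>_def open_halfspace_lt)
  then obtain \<F>' where \<F>': "\<F>' \<subseteq> \<F>" "countable \<F>'" "\<Union>\<F>' = \<Union>\<F>" using Lindelof by metis
  have "z \<in> \<Union>\<F>" if z: "z \<notin> ?E" for z
  proof -
    obtain a c where ac: "a \<bullet> z < c" "\<forall>w\<in>?E. c < a \<bullet> w"
      using separating_hyperplane_closed_point[OF convex_epigraph[OF v(3)] closed_epigraph[OF v(4)] z]
      by blast
    from ac(2) have "\<forall>w\<in>?E. c \<le> a \<bullet> w" by (blast intro: less_imp_le)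
    then have "{z. a \<bullet> z < c} \<in> \<F>" unfolding \<F>_def by blast
    then show ?thesis using ac(1) by blast
  qed
  moreover have "z \<notin> \<Union>\<F>" if "z \<in> ?E" for z
    using that unfolding \<F>_def by fastforce
  ultimately have E: "z \<in> ?E \<longleftrightarrow> z \<notin> \<Union>\<F>'" for z unfolding \<F>'(3) by blast
  have "(x0, r0 - 1) \<notin> ?E" by (simp add: x0)
  then have "\<F>' \<noteq> {}" using E by blast
  define G where "G = from_nat_into \<F>'"
  have G: "range G = \<F>'" unfolding G_def using \<F>' \<open>\<F>' \<noteq> {}\<close> by (simp add: range_from_nat_into)
  have "\<exists>a c. G i = {z. a \<bullet> z < c} \<and> (\<forall>w\<in>?E. c \<le> a \<bullet> w)" for i
    using G \<F>'(1) unfolding \<F>_def by blast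
  then obtain a b where ab: "\<And>i. G i = {z. a i \<bullet> z < b i}" "\<And>i w. w \<in> ?E \<Longrightarrow> b i \<le> a i \<bullet> w"
    by metis
  have repr: "v x \<le> ereal t \<longleftrightarrow> (\<forall>i. b i \<le> fst (a i) \<bullet> x + snd (a i) * t)" for x t
  proof -
    have "v x \<le> ereal t \<longleftrightarrow> (x, t) \<notin> \<Union>(range G)" using E[of "(x, t)"] G by simp
    also have "\<dots> \<longleftrightarrow> (\<forall>i. \<not> a i \<bullet> (x, t) < b i)" by (auto simp: ab(1))
    finally show ?thesis by (simp add: inner_prod_def not_less)
  qed
  have "snd (a i) \<ge> 0" for i
  proof (rule ccontr)
    assume neg: "\<not> snd (a i) \<ge> 0"
    let ?m = "fst (a i) \<bullet> x0 + snd (a i) * r0 - b i"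
    \<comment> \<open>Raising \<open>(x0, r0)\<close> by \<open>s\<close> would make the inequality
      fail by exactly 1, although the raised point is still in the epigraph.\<close>
    define s where "s = (?m + 1) / (- snd (a i))"
    have "v x0 \<le> ereal r0" by (simp add: x0)
    then have "?m \<ge> 0" using repr[of x0 r0] by (simp add: algebra_simps)
    then have "s \<ge> 0" unfolding s_def using neg by (intro divide_nonneg_pos) auto
    then have "v x0 \<le> ereal (r0 + s)" by (simp add: x0)
    then have "b i \<le> fst (a i) \<bullet> x0 + snd (a i) * (r0 + s)" using repr by blast
    moreover have "snd (a i) * s = - (?m + 1)" using neg by (simp add: s_def field_simps)
    ultimately show False by (simp add: distrib_left)
  qed
  then show ?thesis using repr by (rule that)
qed

section \<open>Approximation of coercive functions and constancy of the valuation\<close>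

context epi_invariant_valuation
begin

text \<open>The first \<open>k + 1\<close> halfspaces of the epigraph, taken over a box of radius
  \<open>k\<close>, give a maximum of affine functions on a polytope. These approximations have
  value \<open>Z0\<close> and epi-converge to \<open>v\<close>.\<close>

lemma Z_eq_Z0:
  assumes v: "v \<in> Conv_coe"
  shows "Z v = Z0"
proof -
  have "v \<in> Conv" using v by (simp add: Conv_coe_def)
  then obtain p :: "nat \<Rightarrow> 'a" and q b :: "nat \<Rightarrow> real"
    where q: "\<And>i. q i \<ge> 0" and repr: "\<And>x t. v x \<le> ereal t \<longleftrightarrow> (\<forall>i. b i \<le> p i \<bullet> x + q i * t)"
    using epigraph_eq_countable_Inter_halfspaces by metis
  obtain x0 r0 where x0: "v x0 = ereal r0"
    using \<open>v \<in> Conv\<close> unfolding Conv_def mem_Collect_eq by (metis ereal_cases)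
  \<comment> \<open>A halfspace separating \<open>(x0, r0 - 1)\<close> from the epigraph contains
    \<open>(x0, r0)\<close> and therefore is not vertical.\<close>
  have "\<not> v x0 \<le> ereal (r0 - 1)" "v x0 \<le> ereal r0" by (simp_all add: x0)
  then obtain i0 where "p i0 \<bullet> x0 + q i0 * (r0 - 1) < b i0" "b i0 \<le> p i0 \<bullet> x0 + q i0 * r0"
    unfolding repr by (auto simp: not_le)
  then have i0: "q i0 > 0" by (simp add: algebra_simps)
  \<comment> \<open>Vertical halfspaces become domain constraints; their slot is filled with a fixed minorant.\<close>
  define \<psi> where "\<psi> i = (if q i > 0 then i else i0)" for i
  define P where "P i = - (1 / q (\<psi> i)) *\<^sub>R p (\<psi> i)" for i
  define c where "c i = b (\<psi> i) / q (\<psi> i)" for i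
  have q\<psi>: "q (\<psi> i) > 0" for i using i0 by (simp add: \<psi>_def)
  \<comment> \<open>Dividing by \<open>q (\<psi> i) > 0\<close> turns the halfspace into the
    epigraph of an affine function.\<close>
  have le_iff: "P i \<bullet> x + c i \<le> t \<longleftrightarrow> b (\<psi> i) \<le> p (\<psi> i) \<bullet> x + q (\<psi> i) * t" for i x t
  proof -
    have "P i \<bullet> x + c i = (b (\<psi> i) - p (\<psi> i) \<bullet> x) / q (\<psi> i)"
      by (simp add: P_def c_def diff_divide_distrib)
    then show ?thesis using q\<psi>[of i] by (simp add: pos_divide_le_eq algebra_simps)
  qed
  have repr': "v x \<le> ereal t \<longleftrightarrow> (\<forall>i. (q i = 0 \<longrightarrow> b i \<le> p i \<bullet> x) \<and> P i \<bullet> x + c i \<le> t)" for x t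
  proof -
    have "b i \<le> p i \<bullet> x + q i * t"
      if "q i = 0 \<longrightarrow> b i \<le> p i \<bullet> x" "P i \<bullet> x + c i \<le> t" for i
      using that q[of i] by (cases "q i = 0") (auto simp: le_iff \<psi>_def)
    moreover have "b i \<le> p i \<bullet> x" if "b i \<le> p i \<bullet> x + q i * t" "q i = 0" for i
      using that by simp
    moreover have "b (\<psi> i) \<le> p (\<psi> i) \<bullet> x + q (\<psi> i) * t" if "v x \<le> ereal t" for i
      using that repr by blast
    ultimately show ?thesis using repr[of x t] le_iff by blast
  qed
  \<comment> \<open>The box makes \<open>K k\<close> bounded; centred at \<open>x0\<close>, it keeps
    \<open>K k\<close> nonempty and exhausts the space as \<open>k\<close> grows.\<close>
  define K where "K k = cbox (x0 - real k *\<^sub>R One) (x0 + real k *\<^sub>R One)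
      \<inter> (\<Inter>i\<in>{i. i \<le> k \<and> q i = 0}. {x. b i \<le> p i \<bullet> x})" for k
  define f where "f k x = Max ((\<lambda>i. P i \<bullet> x + c i) ` {..k})" for k x
  have x0_K: "x0 \<in> K k" for k
  proof -
    have "v x0 \<le> ereal r0" by (simp add: x0)
    then show ?thesis by (auto simp: K_def repr' mem_box inner_simps)
  qed
  have K: "polytope (K k)" for k
  proof -
    have "polyhedron {x. b i \<le> p i \<bullet> x}" for i by (rule polyhedron_halfspace_ge)
    then show ?thesis
      unfolding K_def by (intro polytope_Int_polyhedron polytope_interval polyhedron_Inter) auto
  qed
  have f: "convex_on UNIV (f k)" for k
    unfolding f_def by (intro convex_on_Max convex_on_affine) auto
  have le_f: "P i \<bullet> x + c i \<le> f k x" if "i \<le> k" for i k x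
    unfolding f_def using that by (intro Max_ge) auto
  have f_le: "f k x \<le> t" if "v x \<le> ereal t" for k x t
    unfolding f_def using that repr' by (intro Max.boundedI) auto
  have in_Conv_coe: "restr (f k) (K k) \<in> Conv_coe" for k
    using f K x0_K
    by (intro restr_compact_in_Conv_coe polytope_imp_compact polytope_imp_convex) auto
  have "epi_converges (\<lambda>k. restr (f k) (K k)) v"
  proof (rule epi_convergesI)
    fix x X y assume X: "X \<longlonglongrightarrow> x" and y: "y < v x"
    obtain r where r: "y < ereal r" "ereal r < v x" using ereal_dense2[OF y] by blast
    then have "\<not> v x \<le> ereal r" by simp
    \<comment> \<open>Some constraint excludes \<open>(x, r)\<close>: a vertical one, or an affine
      minorant above \<open>r\<close>. It stays violated near \<open>x\<close> and is part of the
      approximation once \<open>k \<ge> i\<close>.\<close>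
    then obtain i where "q i = 0 \<and> p i \<bullet> x < b i \<or> r < P i \<bullet> x + c i"
      unfolding repr' by (meson not_le)
    then show "\<forall>\<^sub>F k in sequentially. y < restr (f k) (K k) (X k)"
    proof (elim disjE conjE)
      assume i: "q i = 0" "p i \<bullet> x < b i"
      have "(\<lambda>k. p i \<bullet> X k) \<longlonglongrightarrow> p i \<bullet> x" using X by (intro tendsto_intros)
      then have "\<forall>\<^sub>F k in sequentially. p i \<bullet> X k < b i" using i(2) by (rule order_tendstoD)
      then show ?thesis using eventually_ge_at_top[of i]
      proof eventually_elim
        case (elim k)
        then have "X k \<notin> K k" using i(1) by (auto simp: K_def)
        then show ?case using r(1) by (auto simp: restr_def)
      qed
    next
      assume i: "r < P i \<bullet> x + c i"
      have "(\<lambda>k. P i \<bullet> X k + c i) \<longlonglongrightarrow> P i \<bullet> x + c i" using X by (intro tendsto_intros)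
      then have "\<forall>\<^sub>F k in sequentially. r < P i \<bullet> X k + c i" using i by (rule order_tendstoD)
      then show ?thesis using eventually_ge_at_top[of i]
      proof eventually_elim
        case (elim k)
        then have "r < f k (X k)" using le_f[of i k "X k"] by simp
        then have "ereal r < restr (f k) (K k) (X k)" by (simp add: restr_def)
        then show ?case using r(1) by (rule less_trans[rotated])
      qed
    qed
  next
    fix x y assume y: "v x < y"
    obtain t where t: "v x < ereal t" "ereal t < y" using ereal_dense2[OF y] by blast
    \<comment> \<open>As \<open>v x\<close> is finite, \<open>x\<close> meets all vertical
      constraints and \<open>f k x \<le> t\<close> for every \<open>k\<close>; it only remains for
      the box to reach \<open>x\<close>.\<close>
    have "\<forall>\<^sub>F k in sequentially. norm (x - x0) < real k"
      using filterlim_real_sequentially by (simp add: filterlim_at_top_dense)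
    then show "\<forall>\<^sub>F k in sequentially. restr (f k) (K k) x < y"
    proof eventually_elim
      case (elim k)
      have "\<bar>(x - x0) \<bullet> j\<bar> \<le> real k" if "j \<in> Basis" for j
        using Basis_le_norm[OF that, of "x - x0"] elim by linarith
      then have "x \<in> cbox (x0 - real k *\<^sub>R One) (x0 + real k *\<^sub>R One)"
        by (force simp: mem_box inner_simps abs_le_iff)
      then have "x \<in> K k" using t(1) repr'[of x t] by (auto simp: K_def)
      moreover have "f k x \<le> t" using t(1) by (intro f_le) simp
      ultimately have "restr (f k) (K k) x \<le> ereal t" by (simp add: restr_def)
      then show ?case using t(2) by (rule le_less_trans)
    qed
  qed
  then have "(\<lambda>k. Z (restr (f k) (K k))) \<longlonglongrightarrow> Z v"
    by (intro Z_tendsto in_Conv_coe v)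
  moreover have "Z (restr (f k) (K k)) = Z0" for k
  proof -
    have "f k = (\<lambda>x. Max ((\<lambda>i. P i \<bullet> x + c i) ` {..k}))" by (simp add: f_def fun_eq_iff)
    moreover have "K k \<noteq> {}" using x0_K by blast
    ultimately show ?thesis using Z_Max_affine[OF K[of k], of "{..k}" P c] by simp
  qed
  ultimately show ?thesis by (simp add: LIMSEQ_const_iff)
qed

end

theorem theorem30:
  fixes Z :: "(real ^ 'n \<Rightarrow> ereal) \<Rightarrow> real"
  assumes "epi_continuous_on Conv_coe Z"
    and "epi_translation_invariant_on Conv_coe Z"
    and "valuation_on Conv_coe Z"
  shows "Z constant_on Conv_coe"
proof -
  interpret epi_invariant_valuation Z by unfold_locales (fact assms)+
  show ?thesis using Z_eq_Z0 by (auto simp: constant_on_def)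
qed

end
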